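(* Assume the setting below and that the two conditions (1) and (2) below hold. Let $\mathcal{V}\subseteq\prod_{i\in N}\mathrm{Obj}(\mathbb{E}_{X_i})$. (i) $\mathcal{V}$ is an invariant for the Duplicator in the composite codensity game $\mathcal{G}$ if $\bigsqcup_{(P_i)_i\in\mathcal{V}}T^{\Omega}_{\sigma}(P_1,\dots,P_N)$ is an $F^{\Omega}_{\tau}$-bisimulation on the composite coalgebra $\lambda\circ T(c_1,\dots,c_N)$. (ii) $\overline{\mathcal{V}}$ is an invariant for the Duplicator in $\mathcal{G}$ if and only if $\bigsqcup_{(P_i)_i\in\overline{\mathcal{V}}}T^{\Omega}_{\sigma}(P_1,\dots,P_N)$ is an $F^{\Omega}_{\tau}$-bisimulation on $\lambda\circ T(c_1,\dots,c_N)$.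
   Context: Setting: $(p\colon\mathbb{E}\to\mathbb{B},O,\Omega)$ is a $\mathbf{CLat}_\sqcap$-fibration with truth values indexed by discrete $A$ (fibers are complete lattices with order $\sqsubseteq$, meet $\bigwedge$, join $\bigsqcup$, meet-preserving reindexing; $O=p\circ\Omega$); $F\colon\mathbb{B}\to\mathbb{B}$, $\tau\colon F\circ O\Rightarrow O$; $(T\colon\mathbb{B}^N\to\mathbb{B},\lambda\colon T\circ F^N\Rightarrow F\circ T)$ an $N$-ary one-step composition; $\sigma\colon T\circ\langle O,\dots,O\rangle\Rightarrow O$; $c_i\colon X_i\to FX_i$ ($i\in N$) are $F$-coalgebras. $F^{\Omega}_{\tau}(P)=\bigwedge_{a,\,k\in\mathbb{E}(P,\Omega(a))}(\tau_a\circ F(pk))^*\Omega(a)$ and $T^{\Omega}_{\sigma}(P_1,\dots,P_N)=\bigwedge_{a,\,k_i\in\mathbb{E}(P_i,\Omega(a))}(\sigma_a\circ T(pk_1,\dots,pk_N))^*\Omega(a)$. An $F^{\Omega}_{\tau}$-bisimulation on $c\colon X\to FX$ is $P\in\mathbb{E}_X$ with $P\sqsubseteq c^*F^{\Omega}_{\tau}(P)$. Conditions: (1) $\sigma_a\circ T(\tau_a,\dots,\tau_a)=\tau_a\circ F\sigma_a\circ\lambda$ for each $a\in A$; (2) for all $P_i\in\mathbb{E}$, $\bigwedge_{a,\,k_i\in\mathbb{E}(P_i,\Omega(a))}(\tau_a\circ F(\sigma_a\circ T(pk_1,\dots,pk_N)))^*\Omega(a)=F^{\Omega}_{\tau}(T^{\Omega}_{\sigma}(P_1,\dots,P_N))$.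 The composite codensity game $\mathcal{G}$ is the safety game with Duplicator positions $(a,(k_i)_i)$, $a\in A$, $k_i\in\mathbb{B}(X_i,O(a))$, Spoiler positions $(P_i)_i\in\prod_i\mathrm{Obj}(\mathbb{E}_{X_i})$, and moves $(P_i)_i\to(a,(k_i)_i)$ if $T^{\Omega}_{\sigma}(P_1,\dots,P_N)\not\sqsubseteq(\sigma_a\circ T(\tau_a\circ Fk_1\circ c_1,\dots,\tau_a\circ Fk_N\circ c_N))^*\Omega(a)$, and $(a,(k_i)_i)\to(P'_i)_i$ if there is $i$ with $P'_i\not\sqsubseteq k_i^*\Omega(a)$; Spoiler wins finite plays ending at a Duplicator position. A set $\mathcal{V}$ of Spoiler positions is an invariant for Duplicator if whenever $q\in\mathcal{V}$ and $q\to q'$ there is $q''\in\mathcal{V}$ with $q'\to q''$. The join-closure is $\overline{\mathcal{V}}=\mathcal{V}\cup\{(\bigsqcup_{(P_j)_j\in\mathcal{V}}P_i)_{i\in N}\}$. *)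

theory Defs
  imports "HOL-Algebra.Complete_Lattice" "HOL-Library.FuncSet"
begin

section \<open>Categories, functors and natural transformations\<close>

record ('o, 'm) category =
  Obj :: "'o set"
  Arr :: "'m set"
  Dom :: "'m \<Rightarrow> 'o"
  Cod :: "'m \<Rightarrow> 'o"
  Ide :: "'o \<Rightarrow> 'm"
  Comp :: "'m \<Rightarrow> 'm \<Rightarrow> 'm"  (infixr \<open>\<cdot>\<index>\<close> 70)

definition Hom :: "('o, 'm) category \<Rightarrow> 'o \<Rightarrow> 'o \<Rightarrow> 'm set" where
  "Hom C X Y = {f \<in> Arr C. Dom C f = X \<and> Cod C f = Y}"

locale category =
  fixes C :: "('o, 'm) category" (structure)
  assumes Dom_in_Obj: "f \<in> Arr C \<Longrightarrow> Dom C f \<in> Obj C"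
    and Cod_in_Obj: "f \<in> Arr C \<Longrightarrow> Cod C f \<in> Obj C"
    and Ide_in_Hom: "X \<in> Obj C \<Longrightarrow> Ide C X \<in> Hom C X X"
    and Comp_in_Hom: "f \<in> Hom C X Y \<Longrightarrow> g \<in> Hom C Y Z \<Longrightarrow> g \<cdot> f \<in> Hom C X Z"
    and Comp_Ide: "f \<in> Hom C X Y \<Longrightarrow> f \<cdot> Ide C X = f"
    and Ide_Comp: "f \<in> Hom C X Y \<Longrightarrow> Ide C Y \<cdot> f = f"
    and Comp_assoc: "f \<in> Hom C W X \<Longrightarrow> g \<in> Hom C X Y \<Longrightarrow> h \<in> Hom C Y Z
      \<Longrightarrow> (h \<cdot> g) \<cdot> f = h \<cdot> (g \<cdot> f)"

record ('o1, 'm1, 'o2, 'm2) functor_data =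
  ObjMap :: "'o1 \<Rightarrow> 'o2"
  ArrMap :: "'m1 \<Rightarrow> 'm2"

locale cat_functor = dom: category C + cod: category D
  for C :: "('o1, 'm1) category" and D :: "('o2, 'm2) category"
    and F :: "('o1, 'm1, 'o2, 'm2) functor_data" +
  assumes ObjMap_in_Obj: "X \<in> Obj C \<Longrightarrow> ObjMap F X \<in> Obj D"
    and ArrMap_in_Hom: "f \<in> Hom C X Y \<Longrightarrow> ArrMap F f \<in> Hom D (ObjMap F X) (ObjMap F Y)"
    and ArrMap_Ide: "X \<in> Obj C \<Longrightarrow> ArrMap F (Ide C X) = Ide D (ObjMap F X)"
    and ArrMap_Comp: "f \<in> Hom C X Y \<Longrightarrow> g \<in> Hom C Y Z
      \<Longrightarrow> ArrMap F (g \<cdot>\<^bsub>C\<^esub> f) = ArrMap F g \<cdot>\<^bsub>D\<^esub> ArrMap F f"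

definition functor_comp ::
  "('o2, 'm2, 'o3, 'm3) functor_data \<Rightarrow> ('o1, 'm1, 'o2, 'm2) functor_data
    \<Rightarrow> ('o1, 'm1, 'o3, 'm3) functor_data"  (infixr \<open>\<circ>\<^sub>F\<close> 75) where
  "G \<circ>\<^sub>F F = \<lparr>ObjMap = ObjMap G \<circ> ObjMap F, ArrMap = ArrMap G \<circ> ArrMap F\<rparr>"

locale nat_trans = F: cat_functor C D F + G: cat_functor C D G
  for C :: "('o1, 'm1) category" and D :: "('o2, 'm2) category"
    and F G :: "('o1, 'm1, 'o2, 'm2) functor_data" and \<alpha> :: "'o1 \<Rightarrow> 'm2" +
  assumes component: "X \<in> Obj C \<Longrightarrow> \<alpha> X \<in> Hom D (ObjMap F X) (ObjMap G X)"
    and naturality: "f \<in> Hom C X Y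
      \<Longrightarrow> \<alpha> Y \<cdot>\<^bsub>D\<^esub> ArrMap F f = ArrMap G f \<cdot>\<^bsub>D\<^esub> \<alpha> X"

definition disc_cat :: "'a set \<Rightarrow> ('a, 'a) category" where
  "disc_cat A = \<lparr>Obj = A, Arr = A, Dom = (\<lambda>a. a), Cod = (\<lambda>a. a), Ide = (\<lambda>a. a),
     Comp = (\<lambda>b a. a)\<rparr>"

text \<open>Families indexed by \<open>N\<close> are represented by functions that are extensional on \<open>N\<close>, so that
  equality of objects and of arrows in the power category is componentwise equality on \<open>N\<close>.\<close>

definition power_cat :: "'i set \<Rightarrow> ('o, 'm) category \<Rightarrow> ('i \<Rightarrow> 'o, 'i \<Rightarrow> 'm) category" where
  "power_cat N C = \<lparr>Obj = (N \<rightarrow>\<^sub>E Obj C), Arr = (N \<rightarrow>\<^sub>E Arr C),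
     Dom = (\<lambda>f. \<lambda>i\<in>N. Dom C (f i)), Cod = (\<lambda>f. \<lambda>i\<in>N. Cod C (f i)),
     Ide = (\<lambda>X. \<lambda>i\<in>N. Ide C (X i)), Comp = (\<lambda>g f. \<lambda>i\<in>N. g i \<cdot>\<^bsub>C\<^esub> f i)\<rparr>"

definition power_functor :: "'i set \<Rightarrow> ('o1, 'm1, 'o2, 'm2) functor_data
    \<Rightarrow> ('i \<Rightarrow> 'o1, 'i \<Rightarrow> 'm1, 'i \<Rightarrow> 'o2, 'i \<Rightarrow> 'm2) functor_data" where
  "power_functor N F =
    \<lparr>ObjMap = (\<lambda>X. \<lambda>i\<in>N. ObjMap F (X i)), ArrMap = (\<lambda>f. \<lambda>i\<in>N. ArrMap F (f i))\<rparr>"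

text \<open>The tuple \<open>\<langle>F, \<dots>, F\<rangle>\<close>.\<close>

definition diag_functor :: "'i set \<Rightarrow> ('o1, 'm1, 'o2, 'm2) functor_data
    \<Rightarrow> ('o1, 'm1, 'i \<Rightarrow> 'o2, 'i \<Rightarrow> 'm2) functor_data" where
  "diag_functor N F =
    \<lparr>ObjMap = (\<lambda>X. \<lambda>i\<in>N. ObjMap F X), ArrMap = (\<lambda>f. \<lambda>i\<in>N. ArrMap F f)\<rparr>"


section \<open>Fibrations of complete lattices\<close>

text \<open>Below, \<open>E\<close> is the total category, \<open>B\<close> the base category and \<open>p\<close> a functor from \<open>E\<close>
  to \<open>B\<close>.\<close>

definition cartesian :: "('e, 'f) category \<Rightarrow> ('b, 'm) category
    \<Rightarrow> ('e, 'f, 'b, 'm) functor_data \<Rightarrow> 'f \<Rightarrow> bool" where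
  "cartesian E B p \<phi> \<longleftrightarrow> \<phi> \<in> Arr E \<and>
    (\<forall>R \<in> Obj E. \<forall>\<psi> \<in> Hom E R (Cod E \<phi>). \<forall>w \<in> Hom B (ObjMap p R) (ObjMap p (Dom E \<phi>)).
      ArrMap p \<psi> = ArrMap p \<phi> \<cdot>\<^bsub>B\<^esub> w \<longrightarrow>
      (\<exists>!\<chi>. \<chi> \<in> Hom E R (Dom E \<phi>) \<and> ArrMap p \<chi> = w \<and> \<phi> \<cdot>\<^bsub>E\<^esub> \<chi> = \<psi>))"

locale fibration = cat_functor E B p
  for E :: "('e, 'f) category" and B :: "('b, 'm) category"
    and p :: "('e, 'f, 'b, 'm) functor_data" +
  assumes cartesian_lift: "Q \<in> Obj E \<Longrightarrow> f \<in> Hom B X (ObjMap p Q)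
      \<Longrightarrow> \<exists>\<phi>. cartesian E B p \<phi> \<and> Cod E \<phi> = Q \<and> ArrMap p \<phi> = f"

text \<open>The fibre over \<open>X\<close>, with \<open>P \<sqsubseteq> Q\<close> iff there is a vertical arrow from \<open>P\<close> to \<open>Q\<close>.\<close>

definition fibre :: "('e, 'f) category \<Rightarrow> ('b, 'm) category
    \<Rightarrow> ('e, 'f, 'b, 'm) functor_data \<Rightarrow> 'b \<Rightarrow> 'e gorder" where
  "fibre E B p X = \<lparr>carrier = {P \<in> Obj E. ObjMap p P = X}, eq = (=),
     le = (\<lambda>P Q. \<exists>h \<in> Hom E P Q. ArrMap p h = Ide B X)\<rparr>"

text \<open>The pullback of \<open>Q\<close> along \<open>f\<close>; when the fibres are posets, cartesian lifts of \<open>f\<close> to \<open>Q\<close>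
  all have the same domain.\<close>

definition reindex :: "('e, 'f) category \<Rightarrow> ('b, 'm) category
    \<Rightarrow> ('e, 'f, 'b, 'm) functor_data \<Rightarrow> 'm \<Rightarrow> 'e \<Rightarrow> 'e" where
  "reindex E B p f Q =
    (THE P. \<exists>\<phi> \<in> Hom E P Q. cartesian E B p \<phi> \<and> ArrMap p \<phi> = f)"

locale CLat_fibration = fibration E B p
  for E :: "('e, 'f) category" and B :: "('b, 'm) category"
    and p :: "('e, 'f, 'b, 'm) functor_data" +
  assumes fibre_thin: "X \<in> Obj B \<Longrightarrow> h \<in> Hom E P Q \<Longrightarrow> h' \<in> Hom E P Q
      \<Longrightarrow> ArrMap p h = Ide B X \<Longrightarrow> ArrMap p h' = Ide B X \<Longrightarrow> h = h'"
    and fibre_complete_lattice: "X \<in> Obj B \<Longrightarrow> complete_lattice (fibre E B p X)"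
    and reindex_Inf: "f \<in> Hom B X Y \<Longrightarrow> S \<subseteq> carrier (fibre E B p Y)
      \<Longrightarrow> reindex E B p f (\<Sqinter>\<^bsub>fibre E B p Y\<^esub> S) = \<Sqinter>\<^bsub>fibre E B p X\<^esub> (reindex E B p f ` S)"


section \<open>Codensity liftings and bisimulations\<close>

definition codensity_lift :: "('e, 'f) category \<Rightarrow> ('b, 'm) category
    \<Rightarrow> ('e, 'f, 'b, 'm) functor_data \<Rightarrow> 'a set \<Rightarrow> ('a, 'a, 'e, 'f) functor_data
    \<Rightarrow> ('b, 'm, 'b, 'm) functor_data \<Rightarrow> ('a \<Rightarrow> 'm) \<Rightarrow> 'e \<Rightarrow> 'e" where
  "codensity_lift E B p A \<Omega> F \<tau> P =
    \<Sqinter>\<^bsub>fibre E B p (ObjMap F (ObjMap p P))\<^esub>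
      {reindex E B p (\<tau> a \<cdot>\<^bsub>B\<^esub> ArrMap F (ArrMap p k)) (ObjMap \<Omega> a) | a k.
        a \<in> A \<and> k \<in> Hom E P (ObjMap \<Omega> a)}"

definition codensity_lift_power :: "('e, 'f) category \<Rightarrow> ('b, 'm) category
    \<Rightarrow> ('e, 'f, 'b, 'm) functor_data \<Rightarrow> 'a set \<Rightarrow> ('a, 'a, 'e, 'f) functor_data
    \<Rightarrow> 'i set \<Rightarrow> ('i \<Rightarrow> 'b, 'i \<Rightarrow> 'm, 'b, 'm) functor_data \<Rightarrow> ('a \<Rightarrow> 'm) \<Rightarrow> ('i \<Rightarrow> 'e) \<Rightarrow> 'e" where
  "codensity_lift_power E B p A \<Omega> N T \<sigma> P =
    \<Sqinter>\<^bsub>fibre E B p (ObjMap T (\<lambda>i\<in>N. ObjMap p (P i)))\<^esub>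
      {reindex E B p (\<sigma> a \<cdot>\<^bsub>B\<^esub> ArrMap T (\<lambda>i\<in>N. ArrMap p (k i))) (ObjMap \<Omega> a) | a k.
        a \<in> A \<and> k \<in> (\<Pi>\<^sub>E i\<in>N. Hom E (P i) (ObjMap \<Omega> a))}"

definition codensity_bisimulation :: "('e, 'f) category \<Rightarrow> ('b, 'm) category
    \<Rightarrow> ('e, 'f, 'b, 'm) functor_data \<Rightarrow> 'a set \<Rightarrow> ('a, 'a, 'e, 'f) functor_data
    \<Rightarrow> ('b, 'm, 'b, 'm) functor_data \<Rightarrow> ('a \<Rightarrow> 'm) \<Rightarrow> 'b \<Rightarrow> 'm \<Rightarrow> 'e \<Rightarrow> bool" where
  "codensity_bisimulation E B p A \<Omega> F \<tau> X c P \<longleftrightarrow>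
    P \<in> carrier (fibre E B p X) \<and>
    P \<sqsubseteq>\<^bsub>fibre E B p X\<^esub> reindex E B p c (codensity_lift E B p A \<Omega> F \<tau> P)"

definition one_step_composition :: "('b, 'm) category \<Rightarrow> ('b, 'm, 'b, 'm) functor_data
    \<Rightarrow> 'i set \<Rightarrow> ('i \<Rightarrow> 'b, 'i \<Rightarrow> 'm, 'b, 'm) functor_data \<Rightarrow> (('i \<Rightarrow> 'b) \<Rightarrow> 'm) \<Rightarrow> bool" where
  "one_step_composition B F N T lam \<longleftrightarrow>
    cat_functor (power_cat N B) B T \<and>
    nat_trans (power_cat N B) B (T \<circ>\<^sub>F power_functor N F) (F \<circ>\<^sub>F T) lam"


section \<open>Safety games and the composite codensity game\<close>

text \<open>In a safety game Spoiler wins exactly the finite plays that end at a Duplicator position, so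
  the game is determined by its positions and moves.\<close>

record ('s, 'd) safety_game =
  Spoiler_pos :: "'s set"
  Duplicator_pos :: "'d set"
  Spoiler_move :: "('s \<times> 'd) set"
  Duplicator_move :: "('d \<times> 's) set"

definition duplicator_invariant :: "('s, 'd) safety_game \<Rightarrow> 's set \<Rightarrow> bool" where
  "duplicator_invariant G V \<longleftrightarrow> V \<subseteq> Spoiler_pos G \<and>
    (\<forall>q \<in> V. \<forall>q'. (q, q') \<in> Spoiler_move G \<longrightarrow> (\<exists>q'' \<in> V. (q', q'') \<in> Duplicator_move G))"

text \<open>\<open>\<O>\<close> is meant to be \<open>p \<circ>\<^sub>F \<Omega>\<close>, and \<open>c i\<close> a coalgebra on \<open>X i\<close>.\<close>

definition composite_codensity_game :: "('e, 'f) category \<Rightarrow> ('b, 'm) category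
    \<Rightarrow> ('e, 'f, 'b, 'm) functor_data \<Rightarrow> 'a set \<Rightarrow> ('a, 'a, 'b, 'm) functor_data
    \<Rightarrow> ('a, 'a, 'e, 'f) functor_data \<Rightarrow> ('b, 'm, 'b, 'm) functor_data \<Rightarrow> ('a \<Rightarrow> 'm)
    \<Rightarrow> 'i set \<Rightarrow> ('i \<Rightarrow> 'b, 'i \<Rightarrow> 'm, 'b, 'm) functor_data \<Rightarrow> ('a \<Rightarrow> 'm)
    \<Rightarrow> ('i \<Rightarrow> 'b) \<Rightarrow> ('i \<Rightarrow> 'm) \<Rightarrow> ('i \<Rightarrow> 'e, 'a \<times> ('i \<Rightarrow> 'm)) safety_game" where
  "composite_codensity_game E B p A \<O> \<Omega> F \<tau> N T \<sigma> X c =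
    (let S = (\<Pi>\<^sub>E i\<in>N. carrier (fibre E B p (X i)));
         D = (SIGMA a : A. \<Pi>\<^sub>E i\<in>N. Hom B (X i) (ObjMap \<O> a))
     in \<lparr>Spoiler_pos = S, Duplicator_pos = D,
         Spoiler_move = {(P, (a, k)). P \<in> S \<and> (a, k) \<in> D \<and>
           \<not> codensity_lift_power E B p A \<Omega> N T \<sigma> P
             \<sqsubseteq>\<^bsub>fibre E B p (ObjMap T X)\<^esub>
             reindex E B p
               (\<sigma> a \<cdot>\<^bsub>B\<^esub> ArrMap T (\<lambda>i\<in>N. \<tau> a \<cdot>\<^bsub>B\<^esub> ArrMap F (k i) \<cdot>\<^bsub>B\<^esub> c i)) (ObjMap \<Omega> a)},
         Duplicator_move = {((a, k), P'). (a, k) \<in> D \<and> P' \<in> S \<and>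
           (\<exists>i \<in> N. \<not> P' i \<sqsubseteq>\<^bsub>fibre E B p (X i)\<^esub> reindex E B p (k i) (ObjMap \<Omega> a))}\<rparr>)"

definition join_closure :: "('e, 'f) category \<Rightarrow> ('b, 'm) category
    \<Rightarrow> ('e, 'f, 'b, 'm) functor_data \<Rightarrow> 'i set \<Rightarrow> ('i \<Rightarrow> 'b) \<Rightarrow> ('i \<Rightarrow> 'e) set \<Rightarrow> ('i \<Rightarrow> 'e) set" where
  "join_closure E B p N X V = V \<union> {\<lambda>i\<in>N. \<Squnion>\<^bsub>fibre E B p (X i)\<^esub> ((\<lambda>P. P i) ` V)}"

end

theory Submission
  imports Defs
begin

text \<open>A set \<open>\<V>\<close> is an invariant iff every Duplicator position \<open>(a, k)\<close> with \<open>P\<^sub>i \<sqsubseteq> k\<^sub>i\<^sup>*\<Omega>(a)\<close> for all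
  \<open>P \<in> \<V>\<close> and \<open>i\<close> is safe for all of \<open>\<V>\<close>. By condition (1) and naturality of \<open>\<lambda>\<close>, the arrow
  \<open>\<sigma>\<^sub>a \<circ> T(\<tau>\<^sub>a \<circ> F k\<^sub>i \<circ> c\<^sub>i)\<close> in the Spoiler moves is \<open>\<tau>\<^sub>a \<circ> F(\<sigma>\<^sub>a \<circ> T k) \<circ> \<gamma>\<close>, where \<open>\<gamma>\<close> is the composite
  coalgebra. On the other hand, \<open>J\<close> is a bisimulation on \<open>\<gamma>\<close> iff \<open>J \<sqsubseteq> (\<tau>\<^sub>a \<circ> F h \<circ> \<gamma>)\<^sup>*\<Omega>(a)\<close> for all \<open>h\<close> with
  \<open>J \<sqsubseteq> h\<^sup>*\<Omega>(a)\<close>, and taking \<open>h = \<sigma>\<^sub>a \<circ> T k\<close> gives (i). The join-closure has a greatest element \<open>M\<close>,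
  so its join of liftings is the lifting of \<open>M\<close>, for which condition (2) says that the arrows
  \<open>h = \<sigma>\<^sub>a \<circ> T k\<close> suffice; this gives the converse.\<close>

section \<open>Reindexing\<close>

lemma (in category) Hom_Obj:
  "f \<in> Hom C X Y \<Longrightarrow> X \<in> Obj C" "f \<in> Hom C X Y \<Longrightarrow> Y \<in> Obj C"
  by (auto simp: Hom_def Dom_in_Obj Cod_in_Obj)

text \<open>Domains and codomains in the power category are families restricted to \<open>N\<close>.
  Extensionality of \<open>Y\<close> and \<open>Z\<close> makes equality with these families the
  same as equality at each index.\<close>

lemma Hom_power_cat:
  "Y \<in> N \<rightarrow>\<^sub>E Obj C \<Longrightarrow> Z \<in> N \<rightarrow>\<^sub>E Obj C
    \<Longrightarrow> Hom (power_cat N C) Y Z = (\<Pi>\<^sub>E i\<in>N. Hom C (Y i) (Z i))"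
  by (auto simp: Hom_def power_cat_def PiE_iff extensional_def fun_eq_iff restrict_def)

context CLat_fibration
begin

abbreviation fib :: "'b \<Rightarrow> 'e gorder" where
  "fib \<equiv> fibre E B p"

lemma fib_carrier: "P \<in> carrier (fib X) \<longleftrightarrow> P \<in> Obj E \<and> ObjMap p P = X"
  by (simp add: fibre_def)

lemma fib_le: "P \<sqsubseteq>\<^bsub>fib X\<^esub> Q \<longleftrightarrow> (\<exists>h \<in> Hom E P Q. ArrMap p h = Ide B X)"
  by (simp add: fibre_def)

lemma cartesian_factor:
  assumes "cartesian E B p \<phi>" "\<phi> \<in> Hom E P Q" "\<psi> \<in> Hom E R Q"
    "w \<in> Hom B (ObjMap p R) (ObjMap p P)" "ArrMap p \<psi> = ArrMap p \<phi> \<cdot>\<^bsub>B\<^esub> w"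
  obtains \<chi> where "\<chi> \<in> Hom E R P" "ArrMap p \<chi> = w" "\<phi> \<cdot>\<^bsub>E\<^esub> \<chi> = \<psi>"
proof -
  have "Dom E \<phi> = P" "Cod E \<phi> = Q" "R \<in> Obj E"
    using assms(2) dom.Hom_Obj[OF assms(3)] by (auto simp: Hom_def)
  then have "\<exists>\<chi>. \<chi> \<in> Hom E R P \<and> ArrMap p \<chi> = w \<and> \<phi> \<cdot>\<^bsub>E\<^esub> \<chi> = \<psi>"
    using assms unfolding cartesian_def by metis
  then show ?thesis
    using that by blast
qed

text \<open>Factoring \<open>\<psi>\<close> through the cartesian \<open>\<phi>\<close> over the
  identity of \<open>X\<close> yields the vertical arrow. Applied both ways to two cartesian lifts
  of \<open>f\<close>, this identifies their domains by antisymmetry.\<close>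

lemma cartesian_dom_le:
  assumes "cartesian E B p \<phi>" "\<phi> \<in> Hom E P Q" "\<psi> \<in> Hom E R Q"
    "ArrMap p \<phi> = f" "ArrMap p \<psi> = f" "f \<in> Hom B X (ObjMap p Q)"
  shows "R \<sqsubseteq>\<^bsub>fib X\<^esub> P"
proof -
  have "ObjMap p P = X" "ObjMap p R = X"
    using ArrMap_in_Hom[OF assms(2)] ArrMap_in_Hom[OF assms(3)] assms(4-6) by (auto simp: Hom_def)
  moreover have "X \<in> Obj B"
    using cod.Hom_Obj assms(6) by blast
  ultimately obtain \<chi> where "\<chi> \<in> Hom E R P" "ArrMap p \<chi> = Ide B X"
    using cartesian_factor[OF assms(1-3), of "Ide B X"] assms(4-6)
    by (metis cod.Ide_in_Hom cod.Comp_Ide)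
  then show ?thesis
    unfolding fib_le by blast
qed

text \<open>Discharges the definite description in \<open>reindex\<close>: a cartesian lift exists
  because \<open>p\<close> is a fibration, and its domain is unique because the fibre is a partial
  order.\<close>

lemma reindex_lift:
  assumes "Q \<in> Obj E" "f \<in> Hom B X (ObjMap p Q)"
  obtains \<phi> where "\<phi> \<in> Hom E (reindex E B p f Q) Q" "cartesian E B p \<phi>" "ArrMap p \<phi> = f"
proof -
  interpret complete_lattice "fib X"
    using fibre_complete_lattice assms cod.Hom_Obj by blast
  let ?lift = "\<lambda>P. \<exists>\<phi> \<in> Hom E P Q. cartesian E B p \<phi> \<and> ArrMap p \<phi> = f"
  obtain \<phi> where "cartesian E B p \<phi>" "Cod E \<phi> = Q" "ArrMap p \<phi> = f"
    using cartesian_lift assms by blast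
  then have "?lift (Dom E \<phi>)"
    by (auto simp: Hom_def cartesian_def)
  moreover have "P = P'" if lifts: "?lift P" "?lift P'" for P P'
  proof -
    have "P \<in> carrier (fib X)" "P' \<in> carrier (fib X)"
      using lifts assms(2) ArrMap_in_Hom dom.Hom_Obj unfolding fib_carrier
      by (fastforce simp: Hom_def)+
    moreover have "P \<sqsubseteq>\<^bsub>fib X\<^esub> P'" "P' \<sqsubseteq>\<^bsub>fib X\<^esub> P"
      using lifts assms(2) cartesian_dom_le by blast+
    ultimately show ?thesis
      using le_antisym by blast
  qed
  ultimately have "?lift (reindex E B p f Q)"
    unfolding reindex_def by (intro theI[of ?lift "Dom E \<phi>"]) blast+
  then show ?thesis
    using that by blast
qed

lemma reindex_closed:
  assumes "Q \<in> Obj E" "f \<in> Hom B X (ObjMap p Q)"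
  shows "reindex E B p f Q \<in> carrier (fib X)"
proof -
  obtain \<phi> where "\<phi> \<in> Hom E (reindex E B p f Q) Q" "ArrMap p \<phi> = f"
    using reindex_lift[OF assms] by blast
  then show ?thesis
    using ArrMap_in_Hom dom.Hom_Obj assms(2) unfolding fib_carrier by (fastforce simp: Hom_def)
qed

text \<open>A vertical arrow composed with the cartesian lift gives an arrow over \<open>f\<close>;
  conversely, an arrow over \<open>f\<close> factors through that lift. This is the bridge between
  the liftings, which range over arrows of \<open>E\<close>, and the game, which compares objects
  inside fibres.\<close>

lemma le_reindex_iff:
  assumes "Q \<in> Obj E" "f \<in> Hom B X (ObjMap p Q)" "P \<in> carrier (fib X)"
  shows "P \<sqsubseteq>\<^bsub>fib X\<^esub> reindex E B p f Q \<longleftrightarrow> (\<exists>h \<in> Hom E P Q. ArrMap p h = f)"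
proof -
  obtain \<phi> where \<phi>: "\<phi> \<in> Hom E (reindex E B p f Q) Q" "cartesian E B p \<phi>" "ArrMap p \<phi> = f"
    using reindex_lift[OF assms(1,2)] by blast
  show ?thesis
  proof
    assume "P \<sqsubseteq>\<^bsub>fib X\<^esub> reindex E B p f Q"
    then obtain h where h: "h \<in> Hom E P (reindex E B p f Q)" "ArrMap p h = Ide B X"
      unfolding fib_le by blast
    have "\<phi> \<cdot>\<^bsub>E\<^esub> h \<in> Hom E P Q" "ArrMap p (\<phi> \<cdot>\<^bsub>E\<^esub> h) = f"
      using h \<phi> dom.Comp_in_Hom ArrMap_Comp cod.Comp_Ide assms(2) by auto
    then show "\<exists>h \<in> Hom E P Q. ArrMap p h = f"
      by blast
  next
    assume "\<exists>h \<in> Hom E P Q. ArrMap p h = f"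
    then show "P \<sqsubseteq>\<^bsub>fib X\<^esub> reindex E B p f Q"
      using cartesian_dom_le \<phi> assms(2) by blast
  qed
qed

text \<open>Functoriality of reindexing, expressed through lower bounds: an arrow over the composite
  factors through the cartesian lift of \<open>g\<close> by an arrow over \<open>f\<close>, and
  composing with that lift goes back.\<close>

lemma le_reindex_comp:
  assumes "Q \<in> Obj E" "g \<in> Hom B Y (ObjMap p Q)" "f \<in> Hom B X Y" "P \<in> carrier (fib X)"
  shows "P \<sqsubseteq>\<^bsub>fib X\<^esub> reindex E B p f (reindex E B p g Q)
    \<longleftrightarrow> P \<sqsubseteq>\<^bsub>fib X\<^esub> reindex E B p (g \<cdot>\<^bsub>B\<^esub> f) Q"
proof -
  let ?gQ = "reindex E B p g Q"
  obtain \<phi> where \<phi>: "\<phi> \<in> Hom E ?gQ Q" "cartesian E B p \<phi>" "ArrMap p \<phi> = g"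
    using reindex_lift[OF assms(1,2)] by blast
  have gQ: "?gQ \<in> Obj E" "ObjMap p ?gQ = Y"
    using reindex_closed[OF assms(1,2)] by (auto simp: fib_carrier)
  have "(\<exists>h \<in> Hom E P ?gQ. ArrMap p h = f) \<longleftrightarrow> (\<exists>h \<in> Hom E P Q. ArrMap p h = g \<cdot>\<^bsub>B\<^esub> f)"
  proof
    assume "\<exists>h \<in> Hom E P ?gQ. ArrMap p h = f"
    then show "\<exists>h \<in> Hom E P Q. ArrMap p h = g \<cdot>\<^bsub>B\<^esub> f"
      using \<phi> dom.Comp_in_Hom ArrMap_Comp by metis
  next
    assume "\<exists>h \<in> Hom E P Q. ArrMap p h = g \<cdot>\<^bsub>B\<^esub> f"
    then show "\<exists>h \<in> Hom E P ?gQ. ArrMap p h = f"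
      using cartesian_factor[OF \<phi>(2,1)] \<phi>(3) gQ assms(3,4) unfolding fib_carrier by metis
  qed
  then show ?thesis
    using assms gQ cod.Comp_in_Hom by (simp add: le_reindex_iff)
qed

lemma le_fib_Inf:
  assumes "X \<in> Obj B" "S \<subseteq> carrier (fib X)" "P \<in> carrier (fib X)"
  shows "P \<sqsubseteq>\<^bsub>fib X\<^esub> \<Sqinter>\<^bsub>fib X\<^esub> S \<longleftrightarrow> (\<forall>Q \<in> S. P \<sqsubseteq>\<^bsub>fib X\<^esub> Q)"
proof -
  interpret complete_lattice "fib X"
    by (rule fibre_complete_lattice[OF assms(1)])
  show ?thesis
    using assms(2,3) inf_lower inf_greatest inf_closed le_trans by (meson subsetD)
qed

lemma fib_Sup_le:
  assumes "X \<in> Obj B" "S \<subseteq> carrier (fib X)" "P \<in> carrier (fib X)"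
  shows "\<Squnion>\<^bsub>fib X\<^esub> S \<sqsubseteq>\<^bsub>fib X\<^esub> P \<longleftrightarrow> (\<forall>Q \<in> S. Q \<sqsubseteq>\<^bsub>fib X\<^esub> P)"
proof -
  interpret complete_lattice "fib X"
    by (rule fibre_complete_lattice[OF assms(1)])
  show ?thesis
    using assms(2,3) sup_upper sup_least sup_closed le_trans by (meson subsetD)
qed

text \<open>Meet preservation of reindexing enters here. It lets an inequality into a reindexed
  codensity lifting be tested on each member of the meet.\<close>

lemma le_reindex_Inf:
  assumes "f \<in> Hom B X Y" "S \<subseteq> carrier (fib Y)" "P \<in> carrier (fib X)"
  shows "P \<sqsubseteq>\<^bsub>fib X\<^esub> reindex E B p f (\<Sqinter>\<^bsub>fib Y\<^esub> S)
    \<longleftrightarrow> (\<forall>Q \<in> S. P \<sqsubseteq>\<^bsub>fib X\<^esub> reindex E B p f Q)"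
proof -
  have "reindex E B p f ` S \<subseteq> carrier (fib X)"
    using assms(1,2) reindex_closed by (auto simp: fib_carrier)
  then show ?thesis
    using assms reindex_Inf le_fib_Inf cod.Hom_Obj by auto
qed

end

section \<open>The composite coalgebra\<close>

text \<open>Since \<open>A\<close> is discrete, \<open>\<Omega>\<close>, \<open>\<tau>\<close> and
  \<open>\<sigma>\<close> enter through the typing of their values at each \<open>a\<close>.
  \<open>compat\<close> and \<open>lift_comp\<close> are conditions (1) and (2), with the truth
  value objects written as images of \<open>\<Omega>\<close> under \<open>p\<close>.\<close>

locale composite_coalgebra = CLat_fibration E B p + F: cat_functor B B F
    + T: cat_functor "power_cat N B" B T
    + lam: nat_trans "power_cat N B" B "T \<circ>\<^sub>F power_functor N F" "F \<circ>\<^sub>F T" lam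
  for E :: "('e, 'f) category" and B :: "('b, 'm) category"
    and p :: "('e, 'f, 'b, 'm) functor_data"
    and F :: "('b, 'm, 'b, 'm) functor_data"
    and N :: "'i set" and T :: "('i \<Rightarrow> 'b, 'i \<Rightarrow> 'm, 'b, 'm) functor_data"
    and lam :: "('i \<Rightarrow> 'b) \<Rightarrow> 'm" +
  fixes A :: "'a set" and \<Omega> :: "('a, 'a, 'e, 'f) functor_data"
    and \<tau> :: "'a \<Rightarrow> 'm" and \<sigma> :: "'a \<Rightarrow> 'm" and X :: "'i \<Rightarrow> 'b" and c :: "'i \<Rightarrow> 'm"
  assumes \<Omega>_Obj: "a \<in> A \<Longrightarrow> ObjMap \<Omega> a \<in> Obj E"
    and \<tau>_Hom: "a \<in> A \<Longrightarrow>
      \<tau> a \<in> Hom B (ObjMap F (ObjMap p (ObjMap \<Omega> a))) (ObjMap p (ObjMap \<Omega> a))"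
    and \<sigma>_Hom: "a \<in> A \<Longrightarrow>
      \<sigma> a \<in> Hom B (ObjMap T (\<lambda>i\<in>N. ObjMap p (ObjMap \<Omega> a))) (ObjMap p (ObjMap \<Omega> a))"
    and X_Obj: "X \<in> N \<rightarrow>\<^sub>E Obj B"
    and c_Hom: "c \<in> (\<Pi>\<^sub>E i\<in>N. Hom B (X i) (ObjMap F (X i)))"
    and compat: "a \<in> A \<Longrightarrow> \<sigma> a \<cdot>\<^bsub>B\<^esub> ArrMap T (\<lambda>i\<in>N. \<tau> a)
      = \<tau> a \<cdot>\<^bsub>B\<^esub> ArrMap F (\<sigma> a) \<cdot>\<^bsub>B\<^esub> lam (\<lambda>i\<in>N. ObjMap p (ObjMap \<Omega> a))"
    and lift_comp: "P \<in> N \<rightarrow>\<^sub>E Obj E \<Longrightarrow>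
      \<Sqinter>\<^bsub>fibre E B p (ObjMap F (ObjMap T (\<lambda>i\<in>N. ObjMap p (P i))))\<^esub>
        {reindex E B p
            (\<tau> a \<cdot>\<^bsub>B\<^esub> ArrMap F (\<sigma> a \<cdot>\<^bsub>B\<^esub> ArrMap T (\<lambda>i\<in>N. ArrMap p (k i)))) (ObjMap \<Omega> a) | a k.
          a \<in> A \<and> k \<in> (\<Pi>\<^sub>E i\<in>N. Hom E (P i) (ObjMap \<Omega> a))}
      = codensity_lift E B p A \<Omega> F \<tau> (codensity_lift_power E B p A \<Omega> N T \<sigma> P)"
begin

abbreviation "TX \<equiv> ObjMap T X"
abbreviation "O' a \<equiv> ObjMap p (ObjMap \<Omega> a)"
abbreviation "gam \<equiv> lam X \<cdot>\<^bsub>B\<^esub> ArrMap T c"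
abbreviation "pull h a \<equiv> reindex E B p h (ObjMap \<Omega> a)"
abbreviation "Tlift \<equiv> codensity_lift_power E B p A \<Omega> N T \<sigma>"
abbreviation "tuples \<equiv> (\<Pi>\<^sub>E i\<in>N. carrier (fib (X i)))"
abbreviation "game \<equiv> composite_codensity_game E B p A (p \<circ>\<^sub>F \<Omega>) \<Omega> F \<tau> N T \<sigma> X c"
abbreviation "bisim \<equiv> codensity_bisimulation E B p A \<Omega> F \<tau> TX gam"

section \<open>Typing of arrows and the shape of Spoiler's arrow\<close>

lemma O_Obj: "a \<in> A \<Longrightarrow> O' a \<in> Obj B"
  by (simp add: \<Omega>_Obj ObjMap_in_Obj)

lemma T_Obj: "Y \<in> N \<rightarrow>\<^sub>E Obj B \<Longrightarrow> ObjMap T Y \<in> Obj B"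
  using T.ObjMap_in_Obj by (simp add: power_cat_def)

lemma T_Hom:
  "\<lbrakk>k \<in> (\<Pi>\<^sub>E i\<in>N. Hom B (Y i) (Z i)); Y \<in> N \<rightarrow>\<^sub>E Obj B; Z \<in> N \<rightarrow>\<^sub>E Obj B\<rbrakk>
    \<Longrightarrow> ArrMap T k \<in> Hom B (ObjMap T Y) (ObjMap T Z)"
  using T.ArrMap_in_Hom by (simp add: Hom_power_cat)

lemma T_Comp:
  assumes "f \<in> (\<Pi>\<^sub>E i\<in>N. Hom B (W i) (Y i))" "g \<in> (\<Pi>\<^sub>E i\<in>N. Hom B (Y i) (Z i))"
    "W \<in> N \<rightarrow>\<^sub>E Obj B" "Y \<in> N \<rightarrow>\<^sub>E Obj B" "Z \<in> N \<rightarrow>\<^sub>E Obj B"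
  shows "ArrMap T (\<lambda>i\<in>N. g i \<cdot>\<^bsub>B\<^esub> f i) = ArrMap T g \<cdot>\<^bsub>B\<^esub> ArrMap T f"
  \<comment> \<open>Two passes, because \<open>Hom_power_cat\<close> matches only while
    \<open>power_cat\<close> is still folded; afterwards the composition is unfolded to its
    pointwise form.\<close>
  using T.ArrMap_Comp[of f W Y g Z] assms by (simp add: Hom_power_cat) (simp add: power_cat_def)

lemma lam_Hom:
  "Y \<in> N \<rightarrow>\<^sub>E Obj B
    \<Longrightarrow> lam Y \<in> Hom B (ObjMap T (\<lambda>i\<in>N. ObjMap F (Y i))) (ObjMap F (ObjMap T Y))"
  using lam.component[of Y] by (simp add: power_cat_def functor_comp_def power_functor_def)

lemma lam_natural:
  "\<lbrakk>k \<in> (\<Pi>\<^sub>E i\<in>N. Hom B (Y i) (Z i)); Y \<in> N \<rightarrow>\<^sub>E Obj B; Z \<in> N \<rightarrow>\<^sub>E Obj B\<rbrakk>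
    \<Longrightarrow> lam Z \<cdot>\<^bsub>B\<^esub> ArrMap T (\<lambda>i\<in>N. ArrMap F (k i)) = ArrMap F (ArrMap T k) \<cdot>\<^bsub>B\<^esub> lam Y"
  using lam.naturality[of k Y Z] by (simp add: Hom_power_cat functor_comp_def power_functor_def)

lemma gam_Hom: "gam \<in> Hom B TX (ObjMap F TX)"
proof (rule cod.Comp_in_Hom)
  show "ArrMap T c \<in> Hom B TX (ObjMap T (\<lambda>i\<in>N. ObjMap F (X i)))"
    using c_Hom X_Obj F.ObjMap_in_Obj by (intro T_Hom) (auto simp: PiE_iff)
qed (rule lam_Hom[OF X_Obj])

lemma \<sigma>_T_Hom:
  assumes "a \<in> A" "Y \<in> N \<rightarrow>\<^sub>E Obj B" "k \<in> (\<Pi>\<^sub>E i\<in>N. Hom B (Y i) (O' a))"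
  shows "\<sigma> a \<cdot>\<^bsub>B\<^esub> ArrMap T k \<in> Hom B (ObjMap T Y) (O' a)"
proof (rule cod.Comp_in_Hom)
  show "ArrMap T k \<in> Hom B (ObjMap T Y) (ObjMap T (\<lambda>i\<in>N. O' a))"
    using assms O_Obj by (intro T_Hom) (auto simp: PiE_iff)
qed (rule \<sigma>_Hom[OF assms(1)])

lemma \<tau>_F_Hom: "a \<in> A \<Longrightarrow> h \<in> Hom B Y (O' a) \<Longrightarrow> \<tau> a \<cdot>\<^bsub>B\<^esub> ArrMap F h \<in> Hom B (ObjMap F Y) (O' a)"
  using \<tau>_Hom F.ArrMap_in_Hom cod.Comp_in_Hom by blast

text \<open>Functoriality of \<open>T\<close> splits off \<open>T \<tau>\<close>,
  \<open>T F k\<close> and \<open>T c\<close>. Condition (1) replaces \<open>\<sigma>\<close> after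
  \<open>T \<tau>\<close> by \<open>\<tau>\<close>, \<open>F \<sigma>\<close> and
  \<open>lam\<close>; naturality of \<open>lam\<close> at \<open>k\<close> moves \<open>lam\<close>
  next to \<open>T c\<close>, forming \<open>gam\<close>; functoriality of \<open>F\<close> merges
  the rest.\<close>

lemma spoiler_arrow:
  assumes a: "a \<in> A" and k: "k \<in> (\<Pi>\<^sub>E i\<in>N. Hom B (X i) (O' a))"
  shows "\<sigma> a \<cdot>\<^bsub>B\<^esub> ArrMap T (\<lambda>i\<in>N. \<tau> a \<cdot>\<^bsub>B\<^esub> ArrMap F (k i) \<cdot>\<^bsub>B\<^esub> c i)
    = (\<tau> a \<cdot>\<^bsub>B\<^esub> ArrMap F (\<sigma> a \<cdot>\<^bsub>B\<^esub> ArrMap T k)) \<cdot>\<^bsub>B\<^esub> gam"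
proof -
  let ?O = "\<lambda>i\<in>N. O' a" and ?FO = "\<lambda>i\<in>N. ObjMap F (O' a)" and ?FX = "\<lambda>i\<in>N. ObjMap F (X i)"
  let ?Fk = "\<lambda>i\<in>N. ArrMap F (k i)" and ?\<tau> = "\<lambda>i\<in>N. \<tau> a"
  have O: "?O \<in> N \<rightarrow>\<^sub>E Obj B" and FO: "?FO \<in> N \<rightarrow>\<^sub>E Obj B" and FX: "?FX \<in> N \<rightarrow>\<^sub>E Obj B"
    using O_Obj[OF a] X_Obj F.ObjMap_in_Obj by (auto simp: PiE_iff)
  have k': "k \<in> (\<Pi>\<^sub>E i\<in>N. Hom B (X i) (?O i))"
    and c': "c \<in> (\<Pi>\<^sub>E i\<in>N. Hom B (X i) (?FX i))"
    and Fk: "?Fk \<in> (\<Pi>\<^sub>E i\<in>N. Hom B (?FX i) (?FO i))"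
    and \<tau>: "?\<tau> \<in> (\<Pi>\<^sub>E i\<in>N. Hom B (?FO i) (?O i))"
    using k c_Hom F.ArrMap_in_Hom \<tau>_Hom[OF a] by (auto simp: PiE_iff)
  have Fkc: "(\<lambda>i\<in>N. ?Fk i \<cdot>\<^bsub>B\<^esub> c i) \<in> (\<Pi>\<^sub>E i\<in>N. Hom B (X i) (?FO i))"
    using Fk c' cod.Comp_in_Hom by (fastforce simp: PiE_iff)
  \<comment> \<open>The typings are selected by position below; the order is \<open>T k\<close>,
    \<open>T c\<close>, \<open>T F k\<close>, \<open>T \<tau>\<close>, \<open>\<sigma>\<close>,
    \<open>\<tau>\<close>, \<open>lam\<close> at \<open>?O\<close>, \<open>lam\<close> at
    \<open>X\<close>.\<close>
  note homs = T_Hom[OF k' X_Obj O] T_Hom[OF c' X_Obj FX] T_Hom[OF Fk FX FO] T_Hom[OF \<tau> FO O]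
    \<sigma>_Hom[OF a] \<tau>_Hom[OF a] lam_Hom[OF O] lam_Hom[OF X_Obj]
  \<comment> \<open>The general typing of \<open>lam\<close> has a domain built from
    \<open>?O\<close> index by index; it must read \<open>?FO\<close> to compose with
    \<open>T F k\<close>.\<close>
  have lamO: "lam ?O \<in> Hom B (ObjMap T ?FO) (ObjMap F (ObjMap T ?O))"
  proof -
    have "(\<lambda>i\<in>N. ObjMap F (?O i)) = ?FO"
      by auto
    then show ?thesis
      using lam_Hom[OF O] by simp
  qed
  have F\<sigma>: "ArrMap F (\<sigma> a) \<in> Hom B (ObjMap F (ObjMap T ?O)) (ObjMap F (O' a))"
    and FTk: "ArrMap F (ArrMap T k) \<in> Hom B (ObjMap F TX) (ObjMap F (ObjMap T ?O))"
    using homs F.ArrMap_in_Hom by blast+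
  note cih = cod.Comp_in_Hom and ca = cod.Comp_assoc
  have "ArrMap T (\<lambda>i\<in>N. \<tau> a \<cdot>\<^bsub>B\<^esub> ArrMap F (k i) \<cdot>\<^bsub>B\<^esub> c i)
      = ArrMap T (\<lambda>i\<in>N. ?\<tau> i \<cdot>\<^bsub>B\<^esub> (\<lambda>i\<in>N. ?Fk i \<cdot>\<^bsub>B\<^esub> c i) i)"
    by (rule arg_cong[of _ _ "ArrMap T"]) auto
  also have "\<dots> = ArrMap T ?\<tau> \<cdot>\<^bsub>B\<^esub> ArrMap T ?Fk \<cdot>\<^bsub>B\<^esub> ArrMap T c"
    using T_Comp[OF Fkc \<tau> X_Obj FO O] T_Comp[OF c' Fk X_Obj FX FO] by simp
  finally have "\<sigma> a \<cdot>\<^bsub>B\<^esub> ArrMap T (\<lambda>i\<in>N. \<tau> a \<cdot>\<^bsub>B\<^esub> ArrMap F (k i) \<cdot>\<^bsub>B\<^esub> c i)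
      = \<sigma> a \<cdot>\<^bsub>B\<^esub> ArrMap T ?\<tau> \<cdot>\<^bsub>B\<^esub> ArrMap T ?Fk \<cdot>\<^bsub>B\<^esub> ArrMap T c"
    by simp
  also have "\<dots> = (\<sigma> a \<cdot>\<^bsub>B\<^esub> ArrMap T ?\<tau>) \<cdot>\<^bsub>B\<^esub> ArrMap T ?Fk \<cdot>\<^bsub>B\<^esub> ArrMap T c"
    using ca[OF cih[OF homs(2,3)] homs(4,5)] by simp
  also have "\<dots> = (\<tau> a \<cdot>\<^bsub>B\<^esub> ArrMap F (\<sigma> a) \<cdot>\<^bsub>B\<^esub> lam ?O) \<cdot>\<^bsub>B\<^esub> ArrMap T ?Fk \<cdot>\<^bsub>B\<^esub> ArrMap T c"
    using compat[OF a] by simp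
  also have "\<dots> = \<tau> a \<cdot>\<^bsub>B\<^esub> (ArrMap F (\<sigma> a) \<cdot>\<^bsub>B\<^esub> lam ?O) \<cdot>\<^bsub>B\<^esub> ArrMap T ?Fk \<cdot>\<^bsub>B\<^esub> ArrMap T c"
    using ca[OF cih[OF homs(2,3)] cih[OF lamO F\<sigma>] homs(6)] .
  also have "\<dots> = \<tau> a \<cdot>\<^bsub>B\<^esub> ArrMap F (\<sigma> a) \<cdot>\<^bsub>B\<^esub> lam ?O \<cdot>\<^bsub>B\<^esub> ArrMap T ?Fk \<cdot>\<^bsub>B\<^esub> ArrMap T c"
    using ca[OF cih[OF homs(2,3)] lamO F\<sigma>] by simp
  also have "\<dots> = \<tau> a \<cdot>\<^bsub>B\<^esub> ArrMap F (\<sigma> a) \<cdot>\<^bsub>B\<^esub> (lam ?O \<cdot>\<^bsub>B\<^esub> ArrMap T ?Fk) \<cdot>\<^bsub>B\<^esub> ArrMap T c"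
    using ca[OF homs(2,3) lamO] by simp
  also have "\<dots> = \<tau> a \<cdot>\<^bsub>B\<^esub> ArrMap F (\<sigma> a) \<cdot>\<^bsub>B\<^esub> (ArrMap F (ArrMap T k) \<cdot>\<^bsub>B\<^esub> lam X) \<cdot>\<^bsub>B\<^esub> ArrMap T c"
    using lam_natural[OF k' X_Obj O] by simp
  also have "\<dots> = \<tau> a \<cdot>\<^bsub>B\<^esub> ArrMap F (\<sigma> a) \<cdot>\<^bsub>B\<^esub> ArrMap F (ArrMap T k) \<cdot>\<^bsub>B\<^esub> gam"
    using ca[OF homs(2,8) FTk] by simp
  also have "\<dots> = \<tau> a \<cdot>\<^bsub>B\<^esub> ArrMap F (\<sigma> a \<cdot>\<^bsub>B\<^esub> ArrMap T k) \<cdot>\<^bsub>B\<^esub> gam"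
    using ca[OF gam_Hom FTk F\<sigma>] F.ArrMap_Comp[OF homs(1,5)] by simp
  also have "\<dots> = (\<tau> a \<cdot>\<^bsub>B\<^esub> ArrMap F (\<sigma> a \<cdot>\<^bsub>B\<^esub> ArrMap T k)) \<cdot>\<^bsub>B\<^esub> gam"
    using ca[OF gam_Hom F.ArrMap_in_Hom[OF cih[OF homs(1,5)]] homs(6)] by simp
  finally show ?thesis .
qed

section \<open>Tuples over \<open>X\<close> and the lifting of \<open>T\<close>\<close>

text \<open>As \<open>X\<close> is extensional, the restricted family in the definition of the
  lifting is \<open>X\<close> itself, so all liftings of tuples live in the one fibre over
  \<open>TX\<close>.\<close>

lemma tuples_base:
  assumes "P \<in> tuples"
  shows "(\<lambda>i\<in>N. ObjMap p (P i)) = X" "P \<in> N \<rightarrow>\<^sub>E Obj E"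
proof -
  show "(\<lambda>i\<in>N. ObjMap p (P i)) = X"
    using assms X_Obj by (intro extensionalityI[of _ N]) (auto simp: PiE_iff fib_carrier)
  show "P \<in> N \<rightarrow>\<^sub>E Obj E"
    using assms by (auto simp: PiE_iff fib_carrier)
qed

lemma image_tuple_Hom:
  "P \<in> tuples \<Longrightarrow> k \<in> (\<Pi>\<^sub>E i\<in>N. Hom E (P i) Q)
    \<Longrightarrow> (\<lambda>i\<in>N. ArrMap p (k i)) \<in> (\<Pi>\<^sub>E i\<in>N. Hom B (X i) (ObjMap p Q))"
  using ArrMap_in_Hom by (fastforce simp: PiE_iff fib_carrier)

text \<open>Each \<open>k i\<close> has an arrow above it by \<open>le_reindex_iff\<close>; a choice
  of these, restricted to \<open>N\<close>, is an extensional family. Together with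
  \<open>image_tuple_Hom\<close> and \<open>tuple_le_pull\<close> it translates between families in
  \<open>E\<close> and families in \<open>B\<close>.\<close>

lemma lift_tuple_Hom:
  assumes P: "P \<in> tuples" and a: "a \<in> A" and k: "k \<in> (\<Pi>\<^sub>E i\<in>N. Hom B (X i) (O' a))"
    and le: "\<forall>i\<in>N. P i \<sqsubseteq>\<^bsub>fib (X i)\<^esub> pull (k i) a"
  obtains h where "h \<in> (\<Pi>\<^sub>E i\<in>N. Hom E (P i) (ObjMap \<Omega> a))" "(\<lambda>i\<in>N. ArrMap p (h i)) = k"
proof -
  have "\<forall>i\<in>N. \<exists>h. h \<in> Hom E (P i) (ObjMap \<Omega> a) \<and> ArrMap p h = k i"
    using le_reindex_iff[OF \<Omega>_Obj[OF a]] P k le by (fastforce simp: PiE_iff)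
  then obtain h where h: "\<forall>i\<in>N. h i \<in> Hom E (P i) (ObjMap \<Omega> a) \<and> ArrMap p (h i) = k i"
    by metis
  have "(\<lambda>i\<in>N. ArrMap p (restrict h N i)) = k"
    using h k by (intro extensionalityI[of _ N]) (auto simp: PiE_iff)
  with h show ?thesis
    by (intro that[of "restrict h N"]) auto
qed

lemma tuple_le_pull:
  assumes P: "P \<in> tuples" and a: "a \<in> A"
    and k: "k \<in> (\<Pi>\<^sub>E i\<in>N. Hom E (P i) (ObjMap \<Omega> a))" and i: "i \<in> N"
  shows "P i \<sqsubseteq>\<^bsub>fib (X i)\<^esub> pull (ArrMap p (k i)) a"
proof -
  have "ArrMap p (k i) \<in> Hom B (X i) (O' a)" "P i \<in> carrier (fib (X i))"
    "k i \<in> Hom E (P i) (ObjMap \<Omega> a)"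
    using image_tuple_Hom[OF P k] P k i by (auto simp: PiE_iff)
  then show ?thesis
    using le_reindex_iff[OF \<Omega>_Obj[OF a]] by blast
qed

lemma tuple_pull_closed:
  "\<lbrakk>a \<in> A; P \<in> tuples; k \<in> (\<Pi>\<^sub>E i\<in>N. Hom E (P i) (ObjMap \<Omega> a))\<rbrakk>
    \<Longrightarrow> pull (\<sigma> a \<cdot>\<^bsub>B\<^esub> ArrMap T (\<lambda>i\<in>N. ArrMap p (k i))) a \<in> carrier (fib TX)"
  using \<sigma>_T_Hom[OF _ X_Obj image_tuple_Hom] reindex_closed \<Omega>_Obj by blast

lemma Tlift_closed:
  assumes "P \<in> tuples"
  shows "Tlift P \<in> carrier (fib TX)"
proof -
  interpret complete_lattice "fib TX"
    by (rule fibre_complete_lattice[OF T_Obj[OF X_Obj]])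
  show ?thesis
    unfolding codensity_lift_power_def tuples_base(1)[OF assms]
    by (rule inf_closed) (auto intro: tuple_pull_closed[OF _ assms])
qed

text \<open>The meet defining the lifting depends on arrows of \<open>E\<close> only through their
  images under \<open>p\<close>, and these images are exactly the \<open>k\<close> that lie above
  \<open>P\<close> after pulling back \<open>\<Omega>\<close>. Hence it can be indexed by arrows of
  \<open>B\<close>, as in Duplicator positions.\<close>

lemma le_Tlift_iff:
  assumes P: "P \<in> tuples" and Q: "Q \<in> carrier (fib TX)"
  shows "Q \<sqsubseteq>\<^bsub>fib TX\<^esub> Tlift P \<longleftrightarrow>
    (\<forall>a\<in>A. \<forall>k \<in> (\<Pi>\<^sub>E i\<in>N. Hom B (X i) (O' a)).
      (\<forall>i\<in>N. P i \<sqsubseteq>\<^bsub>fib (X i)\<^esub> pull (k i) a) \<longrightarrow> Q \<sqsubseteq>\<^bsub>fib TX\<^esub> pull (\<sigma> a \<cdot>\<^bsub>B\<^esub> ArrMap T k) a)"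
    (is "_ \<longleftrightarrow> ?R")
proof -
  let ?S = "{pull (\<sigma> a \<cdot>\<^bsub>B\<^esub> ArrMap T (\<lambda>i\<in>N. ArrMap p (k i))) a | a k.
        a \<in> A \<and> k \<in> (\<Pi>\<^sub>E i\<in>N. Hom E (P i) (ObjMap \<Omega> a))}"
  have S: "?S \<subseteq> carrier (fib TX)"
    by (auto intro: tuple_pull_closed[OF _ P])
  have "Q \<sqsubseteq>\<^bsub>fib TX\<^esub> Tlift P \<longleftrightarrow> (\<forall>R\<in>?S. Q \<sqsubseteq>\<^bsub>fib TX\<^esub> R)"
    unfolding codensity_lift_power_def tuples_base(1)[OF P]
    by (rule le_fib_Inf[OF T_Obj[OF X_Obj] S Q])
  also have "\<dots> \<longleftrightarrow> ?R"
  proof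
    assume L: "\<forall>R\<in>?S. Q \<sqsubseteq>\<^bsub>fib TX\<^esub> R"
    show ?R
    proof (intro ballI impI)
      fix a k assume "a \<in> A" "k \<in> (\<Pi>\<^sub>E i\<in>N. Hom B (X i) (O' a))"
        "\<forall>i\<in>N. P i \<sqsubseteq>\<^bsub>fib (X i)\<^esub> pull (k i) a"
      then obtain h where "a \<in> A" "h \<in> (\<Pi>\<^sub>E i\<in>N. Hom E (P i) (ObjMap \<Omega> a))"
        "(\<lambda>i\<in>N. ArrMap p (h i)) = k"
        using lift_tuple_Hom[OF P] by metis
      then show "Q \<sqsubseteq>\<^bsub>fib TX\<^esub> pull (\<sigma> a \<cdot>\<^bsub>B\<^esub> ArrMap T k) a"
        by (intro bspec[OF L]) blast
    qed
  next
    assume R: ?R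
    show "\<forall>R\<in>?S. Q \<sqsubseteq>\<^bsub>fib TX\<^esub> R"
    proof clarify
      fix a k assume a: "a \<in> A" and k: "k \<in> (\<Pi>\<^sub>E i\<in>N. Hom E (P i) (ObjMap \<Omega> a))"
      show "Q \<sqsubseteq>\<^bsub>fib TX\<^esub> pull (\<sigma> a \<cdot>\<^bsub>B\<^esub> ArrMap T (\<lambda>i\<in>N. ArrMap p (k i))) a"
        by (rule R[rule_format, OF a image_tuple_Hom[OF P k]]) (simp add: tuple_le_pull[OF P a k])
    qed
  qed
  finally show ?thesis .
qed

lemma Tlift_le:
  assumes P: "P \<in> tuples" and a: "a \<in> A" and k: "k \<in> (\<Pi>\<^sub>E i\<in>N. Hom B (X i) (O' a))"
    and le: "\<forall>i\<in>N. P i \<sqsubseteq>\<^bsub>fib (X i)\<^esub> pull (k i) a"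
  shows "Tlift P \<sqsubseteq>\<^bsub>fib TX\<^esub> pull (\<sigma> a \<cdot>\<^bsub>B\<^esub> ArrMap T k) a"
proof -
  interpret complete_lattice "fib TX"
    by (rule fibre_complete_lattice[OF T_Obj[OF X_Obj]])
  show ?thesis
    using le_Tlift_iff[OF P Tlift_closed[OF P], THEN iffD1, OF le_refl[OF Tlift_closed[OF P]],
        rule_format, OF a k] le by blast
qed

section \<open>Bisimulations on the composite coalgebra\<close>

lemma le_pull_gam:
  "\<lbrakk>a \<in> A; h \<in> Hom B TX (O' a); J \<in> carrier (fib TX)\<rbrakk> \<Longrightarrow>
    J \<sqsubseteq>\<^bsub>fib TX\<^esub> reindex E B p gam (pull (\<tau> a \<cdot>\<^bsub>B\<^esub> ArrMap F h) a)
      \<longleftrightarrow> J \<sqsubseteq>\<^bsub>fib TX\<^esub> pull ((\<tau> a \<cdot>\<^bsub>B\<^esub> ArrMap F h) \<cdot>\<^bsub>B\<^esub> gam) a"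
  using le_reindex_comp[OF \<Omega>_Obj \<tau>_F_Hom gam_Hom] by blast

text \<open>The inequality \<open>le\<close> provides an arrow of \<open>E\<close> over
  \<open>h\<close>, hence a member of the meet defining the lifting of \<open>F\<close> at
  \<open>J\<close>. The bisimulation lies below the reindexing of that member along
  \<open>gam\<close>.\<close>

lemma bisim_le:
  assumes J: "bisim J" and a: "a \<in> A" and h: "h \<in> Hom B TX (O' a)"
    and le: "J \<sqsubseteq>\<^bsub>fib TX\<^esub> pull h a"
  shows "J \<sqsubseteq>\<^bsub>fib TX\<^esub> pull ((\<tau> a \<cdot>\<^bsub>B\<^esub> ArrMap F h) \<cdot>\<^bsub>B\<^esub> gam) a"
proof -
  let ?S = "{pull (\<tau> a \<cdot>\<^bsub>B\<^esub> ArrMap F (ArrMap p k)) a | a k. a \<in> A \<and> k \<in> Hom E J (ObjMap \<Omega> a)}"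
  have J': "J \<in> carrier (fib TX)" and pJ: "ObjMap p J = TX"
    using J by (auto simp: codensity_bisimulation_def fib_carrier)
  have "?S \<subseteq> carrier (fib (ObjMap F TX))"
  proof clarify
    fix a k assume "a \<in> A" "k \<in> Hom E J (ObjMap \<Omega> a)"
    then show "pull (\<tau> a \<cdot>\<^bsub>B\<^esub> ArrMap F (ArrMap p k)) a \<in> carrier (fib (ObjMap F TX))"
      using reindex_closed[OF \<Omega>_Obj \<tau>_F_Hom] ArrMap_in_Hom pJ by metis
  qed
  moreover have "J \<sqsubseteq>\<^bsub>fib TX\<^esub> reindex E B p gam (\<Sqinter>\<^bsub>fib (ObjMap F TX)\<^esub> ?S)"
    using J by (simp add: codensity_bisimulation_def codensity_lift_def pJ)
  moreover obtain k where "k \<in> Hom E J (ObjMap \<Omega> a)" "ArrMap p k = h"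
    using le le_reindex_iff[OF \<Omega>_Obj[OF a] h J'] by blast
  ultimately have "J \<sqsubseteq>\<^bsub>fib TX\<^esub> reindex E B p gam (pull (\<tau> a \<cdot>\<^bsub>B\<^esub> ArrMap F h) a)"
    using le_reindex_Inf[OF gam_Hom _ J'] a by blast
  then show ?thesis
    using le_pull_gam a h J' by blast
qed

text \<open>Condition (2) writes the lifting of \<open>F\<close> at \<open>Tlift P\<close> as a meet
  over tuples of arrows out of \<open>P\<close> instead of single arrows out of
  \<open>Tlift P\<close>. It is therefore enough to test arrows of the form \<open>\<sigma>\<close>
  after \<open>T k\<close>.\<close>

lemma bisim_TliftI:
  assumes P: "P \<in> tuples"
    and le: "\<And>a k. \<lbrakk>a \<in> A; k \<in> (\<Pi>\<^sub>E i\<in>N. Hom B (X i) (O' a));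
        \<forall>i\<in>N. P i \<sqsubseteq>\<^bsub>fib (X i)\<^esub> pull (k i) a\<rbrakk>
      \<Longrightarrow> Tlift P \<sqsubseteq>\<^bsub>fib TX\<^esub> pull ((\<tau> a \<cdot>\<^bsub>B\<^esub> ArrMap F (\<sigma> a \<cdot>\<^bsub>B\<^esub> ArrMap T k)) \<cdot>\<^bsub>B\<^esub> gam) a"
  shows "bisim (Tlift P)"
proof -
  let ?S = "{pull (\<tau> a \<cdot>\<^bsub>B\<^esub> ArrMap F (\<sigma> a \<cdot>\<^bsub>B\<^esub> ArrMap T (\<lambda>i\<in>N. ArrMap p (k i)))) a | a k.
        a \<in> A \<and> k \<in> (\<Pi>\<^sub>E i\<in>N. Hom E (P i) (ObjMap \<Omega> a))}"
  have S: "\<Sqinter>\<^bsub>fib (ObjMap F TX)\<^esub> ?S = codensity_lift E B p A \<Omega> F \<tau> (Tlift P)"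
    using lift_comp[OF tuples_base(2)[OF P]] unfolding tuples_base(1)[OF P] .
  have S_closed: "?S \<subseteq> carrier (fib (ObjMap F TX))"
  proof clarify
    fix a k assume a: "a \<in> A" and k: "k \<in> (\<Pi>\<^sub>E i\<in>N. Hom E (P i) (ObjMap \<Omega> a))"
    show "pull (\<tau> a \<cdot>\<^bsub>B\<^esub> ArrMap F (\<sigma> a \<cdot>\<^bsub>B\<^esub> ArrMap T (\<lambda>i\<in>N. ArrMap p (k i)))) a
        \<in> carrier (fib (ObjMap F TX))"
      by (rule reindex_closed[OF \<Omega>_Obj[OF a]
            \<tau>_F_Hom[OF a \<sigma>_T_Hom[OF a X_Obj image_tuple_Hom[OF P k]]]])
  qed
  have "\<forall>Q\<in>?S. Tlift P \<sqsubseteq>\<^bsub>fib TX\<^esub> reindex E B p gam Q"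
  proof clarify
    fix a k assume a: "a \<in> A" and k: "k \<in> (\<Pi>\<^sub>E i\<in>N. Hom E (P i) (ObjMap \<Omega> a))"
    let ?k = "\<lambda>i\<in>N. ArrMap p (k i)"
    have "\<forall>i\<in>N. P i \<sqsubseteq>\<^bsub>fib (X i)\<^esub> pull (?k i) a"
      by (simp add: tuple_le_pull[OF P a k])
    then show "Tlift P \<sqsubseteq>\<^bsub>fib TX\<^esub>
        reindex E B p gam (pull (\<tau> a \<cdot>\<^bsub>B\<^esub> ArrMap F (\<sigma> a \<cdot>\<^bsub>B\<^esub> ArrMap T ?k)) a)"
      using le[OF a image_tuple_Hom[OF P k]]
        le_pull_gam[OF a \<sigma>_T_Hom[OF a X_Obj image_tuple_Hom[OF P k]] Tlift_closed[OF P]]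
      by simp
  qed
  then have "Tlift P \<sqsubseteq>\<^bsub>fib TX\<^esub> reindex E B p gam (\<Sqinter>\<^bsub>fib (ObjMap F TX)\<^esub> ?S)"
    by (rule le_reindex_Inf[OF gam_Hom S_closed Tlift_closed[OF P], THEN iffD2])
  then show ?thesis
    unfolding codensity_bisimulation_def S using Tlift_closed[OF P] by blast
qed

section \<open>Invariants and bisimulations\<close>

text \<open>Contraposition of the rules: both kinds of move assert a failed inequality. Duplicator
  has no answer inside \<open>V\<close> at \<open>(a, k)\<close> exactly when every member of
  \<open>V\<close> lies below the pullbacks along \<open>k\<close>, and then no member of
  \<open>V\<close> may allow the move to \<open>(a, k)\<close>.\<close>

lemma invariant_iff:
  assumes V: "V \<subseteq> tuples"
  shows "duplicator_invariant game V \<longleftrightarrow>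
    (\<forall>a\<in>A. \<forall>k \<in> (\<Pi>\<^sub>E i\<in>N. Hom B (X i) (O' a)).
      (\<forall>P\<in>V. \<forall>i\<in>N. P i \<sqsubseteq>\<^bsub>fib (X i)\<^esub> pull (k i) a) \<longrightarrow>
      (\<forall>P\<in>V. Tlift P \<sqsubseteq>\<^bsub>fib TX\<^esub>
        pull ((\<tau> a \<cdot>\<^bsub>B\<^esub> ArrMap F (\<sigma> a \<cdot>\<^bsub>B\<^esub> ArrMap T k)) \<cdot>\<^bsub>B\<^esub> gam) a))"
proof -
  have "duplicator_invariant game V \<longleftrightarrow>
    (\<forall>a\<in>A. \<forall>k \<in> (\<Pi>\<^sub>E i\<in>N. Hom B (X i) (O' a)).
      (\<forall>P\<in>V. \<forall>i\<in>N. P i \<sqsubseteq>\<^bsub>fib (X i)\<^esub> pull (k i) a) \<longrightarrow>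
      (\<forall>P\<in>V. Tlift P \<sqsubseteq>\<^bsub>fib TX\<^esub>
        pull (\<sigma> a \<cdot>\<^bsub>B\<^esub> ArrMap T (\<lambda>i\<in>N. \<tau> a \<cdot>\<^bsub>B\<^esub> ArrMap F (k i) \<cdot>\<^bsub>B\<^esub> c i)) a))"
    using V unfolding duplicator_invariant_def composite_codensity_game_def
    by (simp add: Let_def functor_comp_def) blast
  then show ?thesis
    by (simp add: spoiler_arrow)
qed

text \<open>The join serves to pass between single liftings and the bisimulation: bounds on all
  liftings bound the join, \<open>bisim_le\<close> advances this bound by one step of
  \<open>gam\<close>, and each lifting inherits the result.\<close>

lemma invariant_if_bisim:
  assumes V: "V \<subseteq> tuples" and bis: "bisim (\<Squnion>\<^bsub>fib TX\<^esub> (Tlift ` V))"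
  shows "duplicator_invariant game V"
  unfolding invariant_iff[OF V]
proof (intro ballI impI)
  fix a k P assume a: "a \<in> A" and k: "k \<in> (\<Pi>\<^sub>E i\<in>N. Hom B (X i) (O' a))"
    and le: "\<forall>P\<in>V. \<forall>i\<in>N. P i \<sqsubseteq>\<^bsub>fib (X i)\<^esub> pull (k i) a" and P: "P \<in> V"
  let ?h = "\<sigma> a \<cdot>\<^bsub>B\<^esub> ArrMap T k"
  have TV: "Tlift ` V \<subseteq> carrier (fib TX)"
    using V Tlift_closed by blast
  have h: "?h \<in> Hom B TX (O' a)"
    by (rule \<sigma>_T_Hom[OF a X_Obj k])
  have "\<forall>Q\<in>Tlift ` V. Q \<sqsubseteq>\<^bsub>fib TX\<^esub> pull ?h a"
  proof clarify
    fix Q assume Q: "Q \<in> V"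
    then show "Tlift Q \<sqsubseteq>\<^bsub>fib TX\<^esub> pull ?h a"
      by (intro Tlift_le[OF subsetD[OF V Q] a k] bspec[OF le])
  qed
  then have "\<Squnion>\<^bsub>fib TX\<^esub> (Tlift ` V) \<sqsubseteq>\<^bsub>fib TX\<^esub> pull ?h a"
    by (rule fib_Sup_le[OF T_Obj[OF X_Obj] TV reindex_closed[OF \<Omega>_Obj[OF a] h], THEN iffD2])
  then have "\<Squnion>\<^bsub>fib TX\<^esub> (Tlift ` V) \<sqsubseteq>\<^bsub>fib TX\<^esub> pull ((\<tau> a \<cdot>\<^bsub>B\<^esub> ArrMap F ?h) \<cdot>\<^bsub>B\<^esub> gam) a"
    by (rule bisim_le[OF bis a h])
  then show "Tlift P \<sqsubseteq>\<^bsub>fib TX\<^esub> pull ((\<tau> a \<cdot>\<^bsub>B\<^esub> ArrMap F ?h) \<cdot>\<^bsub>B\<^esub> gam) a"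
    using fib_Sup_le[OF T_Obj[OF X_Obj] TV
        reindex_closed[OF \<Omega>_Obj[OF a] cod.Comp_in_Hom[OF gam_Hom \<tau>_F_Hom[OF a h]]]] P
    by blast
qed

text \<open>Every \<open>k\<close> whose pullbacks dominate \<open>Q\<close> also dominates
  \<open>P\<close>, so the meet for \<open>Q\<close> ranges over fewer terms.\<close>

lemma Tlift_mono:
  assumes P: "P \<in> tuples" and Q: "Q \<in> tuples" and PQ: "\<forall>i\<in>N. P i \<sqsubseteq>\<^bsub>fib (X i)\<^esub> Q i"
  shows "Tlift P \<sqsubseteq>\<^bsub>fib TX\<^esub> Tlift Q"
proof -
  have below: "P i \<sqsubseteq>\<^bsub>fib (X i)\<^esub> R"
    if "i \<in> N" "Q i \<sqsubseteq>\<^bsub>fib (X i)\<^esub> R" "R \<in> carrier (fib (X i))" for i R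
  proof -
    interpret L: complete_lattice "fib (X i)"
      using fibre_complete_lattice X_Obj that(1) by blast
    show ?thesis
      using L.le_trans[of "P i" "Q i" R] that PQ P Q by (auto simp: PiE_iff)
  qed
  show ?thesis
    unfolding le_Tlift_iff[OF Q Tlift_closed[OF P]]
  proof (intro ballI impI)
    fix a k assume a: "a \<in> A" and k: "k \<in> (\<Pi>\<^sub>E i\<in>N. Hom B (X i) (O' a))"
      and le: "\<forall>i\<in>N. Q i \<sqsubseteq>\<^bsub>fib (X i)\<^esub> pull (k i) a"
    show "Tlift P \<sqsubseteq>\<^bsub>fib TX\<^esub> pull (\<sigma> a \<cdot>\<^bsub>B\<^esub> ArrMap T k) a"
    proof (intro Tlift_le[OF P a k] ballI)
      fix i assume i: "i \<in> N"
      show "P i \<sqsubseteq>\<^bsub>fib (X i)\<^esub> pull (k i) a"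
        by (rule below[OF i bspec[OF le i] reindex_closed[OF \<Omega>_Obj[OF a] PiE_mem[OF k i]]])
    qed
  qed
qed

text \<open>Monotonicity collapses the join to \<open>Tlift M\<close>, so
  \<open>bisim_TliftI\<close> applies. A \<open>k\<close> above \<open>M\<close> is above all of
  \<open>V\<close>, which is just the premise needed to use the invariant.\<close>

lemma bisim_if_invariant_greatest:
  assumes V: "V \<subseteq> tuples" and inv: "duplicator_invariant game V"
    and M: "M \<in> V" and greatest: "\<forall>P\<in>V. \<forall>i\<in>N. P i \<sqsubseteq>\<^bsub>fib (X i)\<^esub> M i"
  shows "bisim (\<Squnion>\<^bsub>fib TX\<^esub> (Tlift ` V))"
proof -
  interpret complete_lattice "fib TX"
    by (rule fibre_complete_lattice[OF T_Obj[OF X_Obj]])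
  have M': "M \<in> tuples"
    using V M by blast
  have TV: "Tlift ` V \<subseteq> carrier (fib TX)"
    using V Tlift_closed by blast
  have "\<Squnion>\<^bsub>fib TX\<^esub> (Tlift ` V) \<sqsubseteq>\<^bsub>fib TX\<^esub> Tlift M"
    using Tlift_mono[OF _ M'] V greatest
    by (intro fib_Sup_le[OF T_Obj[OF X_Obj] TV Tlift_closed[OF M'], THEN iffD2]) blast
  moreover have "Tlift M \<sqsubseteq>\<^bsub>fib TX\<^esub> \<Squnion>\<^bsub>fib TX\<^esub> (Tlift ` V)"
    using sup_upper[OF TV] M by blast
  ultimately have "\<Squnion>\<^bsub>fib TX\<^esub> (Tlift ` V) = Tlift M"
    by (rule le_antisym[OF _ _ sup_closed[OF TV] Tlift_closed[OF M']])
  moreover have "bisim (Tlift M)"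
  proof (rule bisim_TliftI[OF M'])
    fix a k assume a: "a \<in> A" and k: "k \<in> (\<Pi>\<^sub>E i\<in>N. Hom B (X i) (O' a))"
      and Mk: "\<forall>i\<in>N. M i \<sqsubseteq>\<^bsub>fib (X i)\<^esub> pull (k i) a"
    \<comment> \<open>Transitivity through \<open>M i\<close> extends the bound from
      \<open>M\<close> to every member of \<open>V\<close>.\<close>
    have "\<forall>P\<in>V. \<forall>i\<in>N. P i \<sqsubseteq>\<^bsub>fib (X i)\<^esub> pull (k i) a"
    proof (intro ballI)
      fix P i assume P: "P \<in> V" and i: "i \<in> N"
      interpret L: complete_lattice "fib (X i)"
        using fibre_complete_lattice X_Obj i by blast
      have "P i \<in> carrier (fib (X i))" "M i \<in> carrier (fib (X i))"
        using P M' V i by (auto simp: PiE_iff)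
      moreover have "pull (k i) a \<in> carrier (fib (X i))"
        by (rule reindex_closed[OF \<Omega>_Obj[OF a] PiE_mem[OF k i]])
      ultimately show "P i \<sqsubseteq>\<^bsub>fib (X i)\<^esub> pull (k i) a"
        using L.le_trans[of "P i" "M i"] greatest Mk P i by simp
    qed
    then show "Tlift M \<sqsubseteq>\<^bsub>fib TX\<^esub>
        pull ((\<tau> a \<cdot>\<^bsub>B\<^esub> ArrMap F (\<sigma> a \<cdot>\<^bsub>B\<^esub> ArrMap T k)) \<cdot>\<^bsub>B\<^esub> gam) a"
      using bspec[OF bspec[OF inv[unfolded invariant_iff[OF V]] a] k] M by blast
  qed
  ultimately show ?thesis
    by simp
qed

text \<open>Supplies the greatest tuple required by \<open>bisim_if_invariant_greatest\<close>. The
  empty \<open>V\<close> is covered as well: \<open>M\<close> then consists of the least elements of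
  the fibres.\<close>

lemma join_closure_greatest:
  fixes V
  defines "M \<equiv> \<lambda>i\<in>N. \<Squnion>\<^bsub>fib (X i)\<^esub> ((\<lambda>P. P i) ` V)"
  assumes V: "V \<subseteq> tuples"
  shows "join_closure E B p N X V \<subseteq> tuples" "M \<in> join_closure E B p N X V"
    "\<forall>P \<in> join_closure E B p N X V. \<forall>i\<in>N. P i \<sqsubseteq>\<^bsub>fib (X i)\<^esub> M i"
proof -
  have M: "M i \<in> carrier (fib (X i)) \<and> (\<forall>P\<in>insert M V. P i \<sqsubseteq>\<^bsub>fib (X i)\<^esub> M i)"
    if i: "i \<in> N" for i
  proof -
    interpret L: complete_lattice "fib (X i)"
      using fibre_complete_lattice X_Obj i by blast
    have S: "(\<lambda>P. P i) ` V \<subseteq> carrier (fib (X i))"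
      using V i by blast
    then show ?thesis
      using L.sup_upper[OF S] L.sup_closed[OF S] L.le_refl i by (auto simp: M_def)
  qed
  have jc: "join_closure E B p N X V = insert M V"
    by (auto simp: join_closure_def M_def)
  show "join_closure E B p N X V \<subseteq> tuples"
    unfolding jc using V M by (auto simp: PiE_iff M_def)
  show "M \<in> join_closure E B p N X V"
    "\<forall>P \<in> join_closure E B p N X V. \<forall>i\<in>N. P i \<sqsubseteq>\<^bsub>fib (X i)\<^esub> M i"
    unfolding jc using M by auto
qed

end

theorem theorem5:
  fixes E :: "('e, 'f) category" and B :: "('b, 'm) category"
    and p :: "('e, 'f, 'b, 'm) functor_data"
    and A :: "'a set" and \<O> :: "('a, 'a, 'b, 'm) functor_data"
    and \<Omega> :: "('a, 'a, 'e, 'f) functor_data"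
    and F :: "('b, 'm, 'b, 'm) functor_data" and \<tau> :: "'a \<Rightarrow> 'm"
    and N :: "'i set" and T :: "('i \<Rightarrow> 'b, 'i \<Rightarrow> 'm, 'b, 'm) functor_data"
    and lam :: "('i \<Rightarrow> 'b) \<Rightarrow> 'm" and \<sigma> :: "'a \<Rightarrow> 'm"
    and X :: "'i \<Rightarrow> 'b" and c :: "'i \<Rightarrow> 'm"
    and \<V> :: "('i \<Rightarrow> 'e) set"
  assumes "CLat_fibration E B p"
    and "cat_functor (disc_cat A) E \<Omega>" and "\<O> = p \<circ>\<^sub>F \<Omega>"
    and "cat_functor B B F" and "nat_trans (disc_cat A) B (F \<circ>\<^sub>F \<O>) \<O> \<tau>"
    and "finite N" and "one_step_composition B F N T lam"
    and "nat_trans (disc_cat A) B (T \<circ>\<^sub>F diag_functor N \<O>) \<O> \<sigma>"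
    and "X \<in> N \<rightarrow>\<^sub>E Obj B" and "c \<in> (\<Pi>\<^sub>E i\<in>N. Hom B (X i) (ObjMap F (X i)))"
    and cond1: "\<forall>a\<in>A. \<sigma> a \<cdot>\<^bsub>B\<^esub> ArrMap T (\<lambda>i\<in>N. \<tau> a)
      = \<tau> a \<cdot>\<^bsub>B\<^esub> ArrMap F (\<sigma> a) \<cdot>\<^bsub>B\<^esub> lam (\<lambda>i\<in>N. ObjMap \<O> a)"
    and cond2: "\<forall>P \<in> N \<rightarrow>\<^sub>E Obj E.
      \<Sqinter>\<^bsub>fibre E B p (ObjMap F (ObjMap T (\<lambda>i\<in>N. ObjMap p (P i))))\<^esub>
        {reindex E B p
            (\<tau> a \<cdot>\<^bsub>B\<^esub> ArrMap F (\<sigma> a \<cdot>\<^bsub>B\<^esub> ArrMap T (\<lambda>i\<in>N. ArrMap p (k i)))) (ObjMap \<Omega> a) | a k.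
          a \<in> A \<and> k \<in> (\<Pi>\<^sub>E i\<in>N. Hom E (P i) (ObjMap \<Omega> a))}
      = codensity_lift E B p A \<Omega> F \<tau> (codensity_lift_power E B p A \<Omega> N T \<sigma> P)"
    and "\<V> \<subseteq> (\<Pi>\<^sub>E i\<in>N. carrier (fibre E B p (X i)))"
  shows
    "(codensity_bisimulation E B p A \<Omega> F \<tau> (ObjMap T X) (lam X \<cdot>\<^bsub>B\<^esub> ArrMap T c)
        (\<Squnion>\<^bsub>fibre E B p (ObjMap T X)\<^esub> (codensity_lift_power E B p A \<Omega> N T \<sigma> ` \<V>))
      \<longrightarrow> duplicator_invariant (composite_codensity_game E B p A \<O> \<Omega> F \<tau> N T \<sigma> X c) \<V>)
    \<and> (duplicator_invariant (composite_codensity_game E B p A \<O> \<Omega> F \<tau> N T \<sigma> X c)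
          (join_closure E B p N X \<V>)
      \<longleftrightarrow> codensity_bisimulation E B p A \<Omega> F \<tau> (ObjMap T X) (lam X \<cdot>\<^bsub>B\<^esub> ArrMap T c)
        (\<Squnion>\<^bsub>fibre E B p (ObjMap T X)\<^esub>
          (codensity_lift_power E B p A \<Omega> N T \<sigma> ` join_closure E B p N X \<V>)))"
proof -
  interpret CLat_fibration E B p
    by (rule assms(1))
  interpret Om: cat_functor "disc_cat A" E \<Omega>
    by (rule assms(2))
  interpret t: nat_trans "disc_cat A" B "F \<circ>\<^sub>F \<O>" \<O> \<tau>
    by (rule assms(5))
  interpret s: nat_trans "disc_cat A" B "T \<circ>\<^sub>F diag_functor N \<O>" \<O> \<sigma>
    by (rule assms(8))
  interpret F: cat_functor B B F
    by (rule assms(4))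
  interpret T: cat_functor "power_cat N B" B T
    using assms(7) by (simp add: one_step_composition_def)
  interpret lam: nat_trans "power_cat N B" B "T \<circ>\<^sub>F power_functor N F" "F \<circ>\<^sub>F T" lam
    using assms(7) by (simp add: one_step_composition_def)
  have \<O>: "ObjMap \<O> a = ObjMap p (ObjMap \<Omega> a)" for a
    by (simp add: assms(3) functor_comp_def)
  interpret composite_coalgebra E B p F N T lam A \<Omega> \<tau> \<sigma> X c
  proof
    show "ObjMap \<Omega> a \<in> Obj E" if "a \<in> A" for a
      using Om.ObjMap_in_Obj that by (simp add: disc_cat_def)
    show "\<tau> a \<in> Hom B (ObjMap F (ObjMap p (ObjMap \<Omega> a))) (ObjMap p (ObjMap \<Omega> a))" if "a \<in> A" for a
      using t.component[of a] that by (simp add: disc_cat_def functor_comp_def \<O>)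
    show "\<sigma> a \<in> Hom B (ObjMap T (\<lambda>i\<in>N. ObjMap p (ObjMap \<Omega> a))) (ObjMap p (ObjMap \<Omega> a))"
      if "a \<in> A" for a
      using s.component[of a] that by (simp add: disc_cat_def functor_comp_def diag_functor_def \<O>)
  qed (use assms(9,10) cond1 cond2 in \<open>auto simp: \<O>\<close>)
  note jc = join_closure_greatest[OF assms(13)]
  show ?thesis
    \<comment> \<open>Replacing \<open>\<O>\<close> by the composite of \<open>p\<close> and
      \<open>\<Omega>\<close> brings the game into the form used in the locale.\<close>
    unfolding assms(3)
    using invariant_if_bisim[OF assms(13)] invariant_if_bisim[OF jc(1)]
      bisim_if_invariant_greatest[OF jc(1) _ jc(2,3)] by blast
qed

end
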